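(* Let $R$ be a ring. Then, for all $\mathfrak{a}\in\mathrm{Ass}_l(R)$ with $\mathfrak{a}\subseteq\mathfrak{l}^s_R$, $S_{l,\mathfrak{a}}(R)\subseteq T_l(R)$, and so there is a ring $R$-homomorphism $Q_{l,\mathfrak{a}}(R)\to Q_l^s(R)$, $s^{-1}r\mapsto s^{-1}r$ (where $s\in S_{l,\mathfrak{a}}(R)$, $r\in R$).
   Context: Rings are associative with $1$ and nonzero. A multiplicative subset $S$ of $R$ is a submonoid of $(R,\cdot)$ with $1\in S$, $0\notin S$. It is a left Ore set if $Sr\cap Rs\neq\emptyset$ for all $r\in R$, $s\in S$; then $\mathrm{ass}(S):=\{r\in R\mid sr=0 \text{ for some } s\in S\}$ is an ideal. A left Ore set $S$ is a left denominator set if $rs=0$ with $r\in R$, $s\in S$ implies $r\in\mathrm{ass}(S)$. $\mathrm{Den}_l(R)$ is the set of left denominator sets of $R$; for $S\in\mathrm{Den}_l(R)$, $S^{-1}R=\{s^{-1}r\mid s\in S,r\in R\}$ is the left localization. $\mathrm{max.Den}_l(R)$ is the (non-empty) set of elements of $\mathrm{Den}_l(R)$ maximal under inclusion. $\mathcal{L}^s_l(R):=\bigcap_{S\in \mathrm{max.Den}_l(R)}S$. $T_l(R)$ is the union of all $S\in\mathrm{Den}_l(R)$ with $S\subseteq\mathcal{L}^s_l(R)$; it is the largest left denominator set of $R$ contained in $\mathcal{L}^s_l(R)$. $Q_l^s(R):=T_l(R)^{-1}R$ and $\mathfrak{l}^s_R:=\mathrm{ass}(T_l(R))$. $\mathrm{Ass}_l(R):=\{\mathrm{ass}(S)\mid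 S\in\mathrm{Den}_l(R)\}$. For $\mathfrak{a}\in\mathrm{Ass}_l(R)$, $S_{l,\mathfrak{a}}(R)$ is the largest (under inclusion) left denominator set $S$ of $R$ with $\mathrm{ass}(S)=\mathfrak{a}$ (it exists), and $Q_{l,\mathfrak{a}}(R):=S_{l,\mathfrak{a}}(R)^{-1}R$. A ring $R$-homomorphism is a ring homomorphism compatible with the canonical maps from $R$. *)

theory Defs
  imports "HOL-Algebra.RingHom"
begin

definition multiplicative_subset :: "('a, 'm) ring_scheme \<Rightarrow> 'a set \<Rightarrow> bool"
  where "multiplicative_subset R S \<longleftrightarrow> submonoid S R \<and> \<zero>\<^bsub>R\<^esub> \<notin> S"

text \<open>\<open>#>\<close> is \<open>r_coset\<close>, which is the elementwise product \<open>{h r | h \<in> H}\<close> in any monoid, so the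
  condition below reads \<open>S r \<inter> R s \<noteq> \<emptyset>\<close>.\<close>

definition left_Ore_set :: "('a, 'm) ring_scheme \<Rightarrow> 'a set \<Rightarrow> bool"
  where "left_Ore_set R S \<longleftrightarrow> multiplicative_subset R S \<and>
    (\<forall>r \<in> carrier R. \<forall>s \<in> S. (S #>\<^bsub>R\<^esub> r) \<inter> (carrier R #>\<^bsub>R\<^esub> s) \<noteq> {})"

definition ass :: "('a, 'm) ring_scheme \<Rightarrow> 'a set \<Rightarrow> 'a set"
  where "ass R S = {r \<in> carrier R. \<exists>s \<in> S. s \<otimes>\<^bsub>R\<^esub> r = \<zero>\<^bsub>R\<^esub>}"

definition Den\<^sub>l :: "('a, 'm) ring_scheme \<Rightarrow> 'a set set"
  where "Den\<^sub>l R = {S. left_Ore_set R S \<and>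
    (\<forall>r \<in> carrier R. \<forall>s \<in> S. r \<otimes>\<^bsub>R\<^esub> s = \<zero>\<^bsub>R\<^esub> \<longrightarrow> r \<in> ass R S)}"

definition max_Den\<^sub>l :: "('a, 'm) ring_scheme \<Rightarrow> 'a set set"
  where "max_Den\<^sub>l R = {S \<in> Den\<^sub>l R. \<forall>S' \<in> Den\<^sub>l R. S \<subseteq> S' \<longrightarrow> S' = S}"

definition Ls\<^sub>l :: "('a, 'm) ring_scheme \<Rightarrow> 'a set"
  where "Ls\<^sub>l R = \<Inter> (max_Den\<^sub>l R)"

definition T\<^sub>l :: "('a, 'm) ring_scheme \<Rightarrow> 'a set"
  where "T\<^sub>l R = \<Union> {S \<in> Den\<^sub>l R. S \<subseteq> Ls\<^sub>l R}"

definition ls :: "('a, 'm) ring_scheme \<Rightarrow> 'a set"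
  where "ls R = ass R (T\<^sub>l R)"

definition Ass\<^sub>l :: "('a, 'm) ring_scheme \<Rightarrow> 'a set set"
  where "Ass\<^sub>l R = ass R ` Den\<^sub>l R"

definition S\<^sub>l :: "('a, 'm) ring_scheme \<Rightarrow> 'a set \<Rightarrow> 'a set"
  where "S\<^sub>l R \<aa> = (GREATEST S. S \<in> Den\<^sub>l R \<and> ass R S = \<aa>)"

text \<open>
  The left localization at a left denominator set \<open>S\<close>: the fraction \<open>s\<^sup>-\<^sup>1 r\<close> is the class of the
  pair \<open>(s, r)\<close>, and two fractions agree iff they can be expanded from the left to the same
  numerator and the same denominator in \<open>S\<close>. (The factors \<open>c\<close>, \<open>d\<close> range over all of \<open>R\<close>; only
  the common denominator has to lie in \<open>S\<close>.)
\<close>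

definition frac_rel :: "('a, 'm) ring_scheme \<Rightarrow> 'a set \<Rightarrow> (('a \<times> 'a) \<times> ('a \<times> 'a)) set"
  where "frac_rel R S = {((s, r), (s', r')). s \<in> S \<and> r \<in> carrier R \<and> s' \<in> S \<and> r' \<in> carrier R \<and>
    (\<exists>c \<in> carrier R. \<exists>d \<in> carrier R.
       c \<otimes>\<^bsub>R\<^esub> s = d \<otimes>\<^bsub>R\<^esub> s' \<and> c \<otimes>\<^bsub>R\<^esub> s \<in> S \<and> c \<otimes>\<^bsub>R\<^esub> r = d \<otimes>\<^bsub>R\<^esub> r')}"

definition left_frac :: "('a, 'm) ring_scheme \<Rightarrow> 'a set \<Rightarrow> 'a \<Rightarrow> 'a \<Rightarrow> ('a \<times> 'a) set"
  where "left_frac R S s r = frac_rel R S `` {(s, r)}"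

text \<open>
  Operations on classes are unions over all representatives, as for other quotients in the library.
  The sum is \<open>u\<^sup>-\<^sup>1 a + u\<^sup>-\<^sup>1 b = u\<^sup>-\<^sup>1 (a + b)\<close>, using representatives with a common denominator; the
  product is \<open>s\<^sup>-\<^sup>1 r \<cdot> t\<^sup>-\<^sup>1 q = (s\<^sub>1 s)\<^sup>-\<^sup>1 (r\<^sub>1 q)\<close> whenever \<open>s\<^sub>1 r = r\<^sub>1 t\<close> with \<open>s\<^sub>1 \<in> S\<close>, which is
  where the left Ore condition enters.
\<close>

definition left_localization :: "('a, 'm) ring_scheme \<Rightarrow> 'a set \<Rightarrow> ('a \<times> 'a) set ring"
  where "left_localization R S =
    \<lparr>carrier = (S \<times> carrier R) // frac_rel R S,
     monoid.mult = (\<lambda>x y. \<Union> {left_frac R S (s\<^sub>1 \<otimes>\<^bsub>R\<^esub> s) (r\<^sub>1 \<otimes>\<^bsub>R\<^esub> q) | s r t q s\<^sub>1 r\<^sub>1.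
        (s, r) \<in> x \<and> (t, q) \<in> y \<and> s\<^sub>1 \<in> S \<and> r\<^sub>1 \<in> carrier R \<and> s\<^sub>1 \<otimes>\<^bsub>R\<^esub> r = r\<^sub>1 \<otimes>\<^bsub>R\<^esub> t}),
     one = left_frac R S \<one>\<^bsub>R\<^esub> \<one>\<^bsub>R\<^esub>,
     zero = left_frac R S \<one>\<^bsub>R\<^esub> \<zero>\<^bsub>R\<^esub>,
     add = (\<lambda>x y. \<Union> {left_frac R S u (a \<oplus>\<^bsub>R\<^esub> b) | u a b. (u, a) \<in> x \<and> (u, b) \<in> y})\<rparr>"

definition Q\<^sub>l :: "('a, 'm) ring_scheme \<Rightarrow> 'a set \<Rightarrow> ('a \<times> 'a) set ring"
  where "Q\<^sub>l R \<aa> = left_localization R (S\<^sub>l R \<aa>)"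

definition Qs\<^sub>l :: "('a, 'm) ring_scheme \<Rightarrow> ('a \<times> 'a) set ring"
  where "Qs\<^sub>l R = left_localization R (T\<^sub>l R)"

definition canonical_map :: "('a, 'm) ring_scheme \<Rightarrow> 'a set \<Rightarrow> 'a \<Rightarrow> ('a \<times> 'a) set"
  where "canonical_map R S r = left_frac R S \<one>\<^bsub>R\<^esub> r"

text \<open>A ring homomorphism \<open>h : A \<rightarrow> B\<close> compatible with maps \<open>\<phi> : R \<rightarrow> A\<close> and \<open>\<psi> : R \<rightarrow> B\<close>. The
  predicate \<open>ring_hom_ring\<close> includes that \<open>A\<close> and \<open>B\<close> are (associative, unital) rings.\<close>

definition ring_hom_under ::
    "('a, 'm) ring_scheme \<Rightarrow> ('b, 'n) ring_scheme \<Rightarrow> ('a \<Rightarrow> 'b) \<Rightarrow>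
     ('c, 'k) ring_scheme \<Rightarrow> ('a \<Rightarrow> 'c) \<Rightarrow> ('b \<Rightarrow> 'c) \<Rightarrow> bool"
  where "ring_hom_under R A \<phi> B \<psi> h \<longleftrightarrow>
    ring_hom_ring A B h \<and> (\<forall>r \<in> carrier R. h (\<phi> r) = \<psi> r)"

end

theory Submission
  imports Defs
begin

text \<open>
  A maximal left denominator set \<open>M\<close> contains \<open>T\<^sub>l R\<close>, so \<open>\<aa> \<subseteq> ass R M\<close>. If \<open>S\<close> and \<open>M\<close> are left
  denominator sets with \<open>ass R S \<subseteq> ass R M\<close>, then any \<open>r\<close> with \<open>r w = 0\<close> for a word \<open>w\<close> in elements
  of \<open>S\<close> and \<open>M\<close> lies in \<open>ass R M\<close>: strip the letters of \<open>w\<close> from the right, each time multiplying from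
  the left by an element of \<open>M\<close>. In particular \<open>w \<noteq> 0\<close>, so the monoid generated by \<open>S \<union> M\<close> is again a
  left denominator set, and maximality of \<open>M\<close> gives \<open>S \<subseteq> M\<close>. Hence \<open>S\<^sub>l R \<aa>\<close> lies in all maximal left
  denominator sets, and therefore in \<open>T\<^sub>l R\<close>; the identity on pairs induces the homomorphism.
\<close>

section \<open>Left denominator sets\<close>

inductive_set monoid_closure :: "('a, 'm) monoid_scheme \<Rightarrow> 'a set \<Rightarrow> 'a set"
  for G and A where
    one: "\<one>\<^bsub>G\<^esub> \<in> monoid_closure G A"
  | incl: "a \<in> A \<Longrightarrow> a \<in> monoid_closure G A"
  | mult: "v \<in> monoid_closure G A \<Longrightarrow> w \<in> monoid_closure G A \<Longrightarrow> v \<otimes>\<^bsub>G\<^esub> w \<in> monoid_closure G A"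

lemma (in monoid) submonoid_monoid_closure:
  assumes "A \<subseteq> carrier G"
  shows "submonoid (monoid_closure G A) G"
proof
  show "monoid_closure G A \<subseteq> carrier G"
  proof
    show "x \<in> carrier G" if "x \<in> monoid_closure G A" for x
      using that by induction (use assms in auto)
  qed
qed (auto intro: monoid_closure.intros)

lemma monoid_closure_minimal:
  assumes "submonoid H G" and "A \<subseteq> H"
  shows "monoid_closure G A \<subseteq> H"
proof
  show "x \<in> H" if "x \<in> monoid_closure G A" for x
    using that by induction (use assms in \<open>auto intro: submonoid.m_closed submonoid.one_closed\<close>)
qed

lemma ass_mono: "S \<subseteq> T \<Longrightarrow> ass R S \<subseteq> ass R T"
  unfolding ass_def by blast

lemma assI: "r \<in> carrier R \<Longrightarrow> s \<in> S \<Longrightarrow> s \<otimes>\<^bsub>R\<^esub> r = \<zero>\<^bsub>R\<^esub> \<Longrightarrow> r \<in> ass R S"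
  unfolding ass_def by blast

lemma assE:
  assumes "r \<in> ass R S"
  obtains s where "r \<in> carrier R" "s \<in> S" "s \<otimes>\<^bsub>R\<^esub> r = \<zero>\<^bsub>R\<^esub>"
  using assms unfolding ass_def by blast

lemma Den_iff:
  "S \<in> Den\<^sub>l R \<longleftrightarrow> submonoid S R \<and> \<zero>\<^bsub>R\<^esub> \<notin> S \<and>
    (\<forall>r \<in> carrier R. \<forall>s \<in> S. \<exists>s' \<in> S. \<exists>r' \<in> carrier R. s' \<otimes>\<^bsub>R\<^esub> r = r' \<otimes>\<^bsub>R\<^esub> s) \<and>
    (\<forall>r \<in> carrier R. \<forall>s \<in> S. r \<otimes>\<^bsub>R\<^esub> s = \<zero>\<^bsub>R\<^esub> \<longrightarrow> r \<in> ass R S)"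
proof -
  have "(S #>\<^bsub>R\<^esub> r) \<inter> (carrier R #>\<^bsub>R\<^esub> s) \<noteq> {} \<longleftrightarrow>
      (\<exists>s' \<in> S. \<exists>r' \<in> carrier R. s' \<otimes>\<^bsub>R\<^esub> r = r' \<otimes>\<^bsub>R\<^esub> s)" for r s
    unfolding r_coset_def by blast
  then show ?thesis
    unfolding Den\<^sub>l_def left_Ore_set_def multiplicative_subset_def by simp
qed

lemma Den_Ore:
  assumes "S \<in> Den\<^sub>l R" and "r \<in> carrier R" and "s \<in> S"
  obtains s' r' where "s' \<in> S" "r' \<in> carrier R" "s' \<otimes>\<^bsub>R\<^esub> r = r' \<otimes>\<^bsub>R\<^esub> s"
  using assms unfolding Den_iff by blast

lemma Den_right_annihilated:
  assumes "S \<in> Den\<^sub>l R" and "r \<in> carrier R" and "s \<in> S" and "r \<otimes>\<^bsub>R\<^esub> s = \<zero>\<^bsub>R\<^esub>"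
  shows "r \<in> ass R S"
  using assms unfolding Den_iff by blast

lemma Den_submonoid: "S \<in> Den\<^sub>l R \<Longrightarrow> submonoid S R"
  and Den_zero: "S \<in> Den\<^sub>l R \<Longrightarrow> \<zero>\<^bsub>R\<^esub> \<notin> S"
  unfolding Den_iff by simp_all

lemma Den_subset: "S \<in> Den\<^sub>l R \<Longrightarrow> S \<subseteq> carrier R"
  by (rule submonoid.subset[OF Den_submonoid])

context ring
begin

lemma ass_multD:
  assumes "submonoid S R" and "s \<in> S" and "r \<in> carrier R" and "s \<otimes> r \<in> ass R S"
  shows "r \<in> ass R S"
proof -
  interpret S: submonoid S R by fact
  obtain t where t: "t \<in> S" "t \<otimes> (s \<otimes> r) = \<zero>"
    using assms(4) by (rule assE)
  then have "(t \<otimes> s) \<otimes> r = \<zero>"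
    using assms(2,3) S.subset by (simp add: m_assoc subset_iff)
  then show ?thesis
    using assms(2,3) t(1) by (blast intro: assI)
qed

lemma Den_monoid_closure:
  assumes F: "F \<subseteq> Den\<^sub>l R" and zero: "\<zero> \<notin> monoid_closure R (\<Union> F)"
  shows "monoid_closure R (\<Union> F) \<in> Den\<^sub>l R"
proof -
  let ?W = "monoid_closure R (\<Union> F)"
  have sub: "submonoid ?W R"
    using F Den_subset by (intro submonoid_monoid_closure) blast
  interpret W: submonoid ?W R by (fact sub)
  have Ore: "\<exists>w' \<in> ?W. \<exists>r' \<in> carrier R. w' \<otimes> r = r' \<otimes> w"
    if "w \<in> ?W" "r \<in> carrier R" for r w
    using that
  proof (induction arbitrary: r)
    case one
    then show ?case
      by (intro bexI[of _ \<one>] bexI[of _ r]) auto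
  next
    case (incl a)
    then obtain S where S: "S \<in> F" "a \<in> S"
      by blast
    then obtain s' r' where "s' \<in> S" "r' \<in> carrier R" "s' \<otimes> r = r' \<otimes> a"
      using F incl.prems by (metis Den_Ore subsetD)
    then show ?case
      using S by (blast intro: monoid_closure.incl)
  next
    case (mult v w)
    obtain w' r' where w': "w' \<in> ?W" "r' \<in> carrier R" "w' \<otimes> r = r' \<otimes> w"
      using mult.IH(2) mult.prems by blast
    obtain v' r'' where v': "v' \<in> ?W" "r'' \<in> carrier R" "v' \<otimes> r' = r'' \<otimes> v"
      using mult.IH(1) w'(2) by blast
    have carr: "v \<in> carrier R" "w \<in> carrier R" "v' \<in> carrier R" "w' \<in> carrier R"
      using mult.hyps v'(1) w'(1) W.subset by auto
    have "(v' \<otimes> w') \<otimes> r = v' \<otimes> (r' \<otimes> w)"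
      using carr mult.prems w'(3) by (simp add: m_assoc)
    also have "\<dots> = (r'' \<otimes> v) \<otimes> w"
      using carr w'(2) by (simp add: m_assoc[symmetric] v'(3))
    also have "\<dots> = r'' \<otimes> (v \<otimes> w)"
      using carr v'(2) by (simp add: m_assoc)
    finally show ?case
      using v'(1,2) w'(1) by blast
  qed
  have ann: "r \<in> ass R ?W" if "w \<in> ?W" "r \<in> carrier R" "r \<otimes> w = \<zero>" for r w
    using that
  proof (induction arbitrary: r)
    case one
    then show ?case
      by (intro assI[of _ _ \<one>]) (auto intro: monoid_closure.one)
  next
    case (incl a)
    then obtain S where S: "S \<in> F" "a \<in> S"
      by blast
    then have "r \<in> ass R S"
      using F incl.prems by (blast intro: Den_right_annihilated)
    moreover have "S \<subseteq> ?W"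
      using S(1) by (blast intro: monoid_closure.incl)
    ultimately show ?case
      using ass_mono by blast
  next
    case (mult v w)
    have carr: "v \<in> carrier R" "w \<in> carrier R"
      using mult.hyps W.subset by auto
    have "r \<otimes> v \<in> ass R ?W"
      using carr mult.prems by (intro mult.IH(2)) (auto simp: m_assoc)
    then obtain t where t: "t \<in> ?W" "t \<otimes> (r \<otimes> v) = \<zero>"
      by (rule assE)
    then have tc: "t \<in> carrier R"
      using W.subset by blast
    have "t \<otimes> r \<in> ass R ?W"
      using carr tc mult.prems(1) t(2) by (intro mult.IH(1)) (auto simp: m_assoc)
    with sub t(1) mult.prems(1) show ?case
      by (rule ass_multD)
  qed
  show ?thesis
    unfolding Den_iff using sub zero Ore ann by blast
qed

lemma Den_monoid_closure_dominated:
  assumes F: "F \<subseteq> Den\<^sub>l R" and M: "M \<in> F" and dom: "\<And>S. S \<in> F \<Longrightarrow> ass R S \<subseteq> ass R M"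
  shows "monoid_closure R (\<Union> F) \<in> Den\<^sub>l R"
proof (rule Den_monoid_closure[OF F])
  let ?W = "monoid_closure R (\<Union> F)"
  have MD: "M \<in> Den\<^sub>l R"
    using F M by blast
  interpret M: submonoid M R
    using MD by (rule Den_submonoid)
  interpret W: submonoid ?W R
    using F Den_subset by (intro submonoid_monoid_closure) blast
  have ann: "r \<in> ass R M" if "w \<in> ?W" "r \<in> carrier R" "r \<otimes> w = \<zero>" for r w
    using that
  proof (induction arbitrary: r)
    case one
    then show ?case
      by (intro assI[of _ _ \<one>]) auto
  next
    case (incl a)
    then obtain S where S: "S \<in> F" "a \<in> S"
      by blast
    then have "r \<in> ass R S"
      using F incl.prems by (blast intro: Den_right_annihilated)
    then show ?case
      using dom[OF S(1)] by blast
  next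
    case (mult v w)
    have carr: "v \<in> carrier R" "w \<in> carrier R"
      using mult.hyps W.subset by auto
    have "r \<otimes> v \<in> ass R M"
      using carr mult.prems by (intro mult.IH(2)) (auto simp: m_assoc)
    then obtain t where t: "t \<in> M" "t \<otimes> (r \<otimes> v) = \<zero>"
      by (rule assE)
    then have tc: "t \<in> carrier R"
      using M.subset by blast
    have "t \<otimes> r \<in> ass R M"
      using carr tc mult.prems(1) t(2) by (intro mult.IH(1)) (auto simp: m_assoc)
    with M.submonoid_axioms t(1) mult.prems(1) show ?case
      by (rule ass_multD)
  qed
  show "\<zero> \<notin> ?W"
  proof
    assume "\<zero> \<in> ?W"
    then have "\<one> \<in> ass R M"
      by (intro ann[of \<zero>]) auto
    then obtain m where "m \<in> M" "m \<otimes> \<one> = \<zero>"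
      by (rule assE)
    then show False
      using Den_zero[OF MD] M.subset by (metis r_one subsetD)
  qed
qed

lemma ass_monoid_closure:
  assumes F: "F \<subseteq> Den\<^sub>l R" and ne: "F \<noteq> {}" and eq: "\<And>S. S \<in> F \<Longrightarrow> ass R S = \<aa>"
  shows "ass R (monoid_closure R (\<Union> F)) = \<aa>"
proof
  let ?W = "monoid_closure R (\<Union> F)"
  obtain M where M: "M \<in> F"
    using ne by blast
  interpret W: submonoid ?W R
    using F Den_subset by (intro submonoid_monoid_closure) blast
  have "M \<subseteq> ?W"
    using M by (blast intro: monoid_closure.incl)
  then show "\<aa> \<subseteq> ass R ?W"
    using eq[OF M] ass_mono by blast
  have strip: "r \<in> \<aa>" if "w \<in> ?W" "r \<in> carrier R" "w \<otimes> r \<in> \<aa>" for r w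
    using that
  proof (induction arbitrary: r)
    case one
    then show ?case by simp
  next
    case (incl a)
    then obtain S where S: "S \<in> F" "a \<in> S"
      by blast
    then show ?case
      using ass_multD[of S a r] F incl.prems eq[OF S(1)] Den_submonoid by blast
  next
    case (mult v w)
    have carr: "v \<in> carrier R" "w \<in> carrier R"
      using mult.hyps W.subset by auto
    have "v \<otimes> (w \<otimes> r) \<in> \<aa>"
      using carr mult.prems by (simp add: m_assoc)
    then show ?case
      using carr mult.IH mult.prems(1) by blast
  qed
  have "\<zero> \<in> ass R M"
    using F M Den_submonoid[of M R] Den_subset[of M R]
    by (intro assI[of _ _ \<one>]) (auto intro: submonoid.one_closed)
  then show "ass R ?W \<subseteq> \<aa>"
    using strip eq[OF M] by (metis assE subsetI)
qed

lemma S\<^sub>l_greatest: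
  assumes "\<aa> \<in> Ass\<^sub>l R"
  shows "S\<^sub>l R \<aa> \<in> Den\<^sub>l R" and "ass R (S\<^sub>l R \<aa>) = \<aa>"
proof -
  define F where "F = {S \<in> Den\<^sub>l R. ass R S = \<aa>}"
  let ?W = "monoid_closure R (\<Union> F)"
  have F: "F \<subseteq> Den\<^sub>l R" "\<And>S. S \<in> F \<Longrightarrow> ass R S = \<aa>"
    unfolding F_def by blast+
  obtain M where M: "M \<in> F"
    using assms unfolding Ass\<^sub>l_def F_def by blast
  have "?W \<in> Den\<^sub>l R"
    using F(1) M by (rule Den_monoid_closure_dominated) (simp add: F(2) M)
  moreover have "ass R ?W = \<aa>"
    using M by (intro ass_monoid_closure F) auto
  ultimately have W: "?W \<in> Den\<^sub>l R" "ass R ?W = \<aa>" .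
  have "S\<^sub>l R \<aa> = ?W"
    unfolding S\<^sub>l_def
  proof (rule Greatest_equality)
    show "?W \<in> Den\<^sub>l R \<and> ass R ?W = \<aa>"
      using W by (rule conjI)
    show "S \<subseteq> ?W" if "S \<in> Den\<^sub>l R \<and> ass R S = \<aa>" for S
    proof
      fix x assume "x \<in> S"
      then have "x \<in> \<Union> F"
        using that unfolding F_def by blast
      then show "x \<in> ?W"
        by (rule monoid_closure.incl)
    qed
  qed
  then show "S\<^sub>l R \<aa> \<in> Den\<^sub>l R" and "ass R (S\<^sub>l R \<aa>) = \<aa>"
    by (simp_all only: W)
qed

lemma subset_max_Den:
  assumes "S \<in> Den\<^sub>l R" and "M \<in> max_Den\<^sub>l R" and "ass R S \<subseteq> ass R M"
  shows "S \<subseteq> M"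
proof -
  let ?W = "monoid_closure R (\<Union> {S, M})"
  have M: "M \<in> Den\<^sub>l R" "\<And>S'. S' \<in> Den\<^sub>l R \<Longrightarrow> M \<subseteq> S' \<Longrightarrow> S' = M"
    using assms(2) unfolding max_Den\<^sub>l_def by auto
  have "?W \<in> Den\<^sub>l R"
    using assms M(1) by (intro Den_monoid_closure_dominated[of _ M]) auto
  moreover have "S \<subseteq> ?W" "M \<subseteq> ?W"
    by (auto intro: monoid_closure.incl)
  ultimately show ?thesis
    using M(2) by metis
qed

lemma singleton_one_Den:
  assumes "\<one> \<noteq> \<zero>"
  shows "{\<one>} \<in> Den\<^sub>l R"
proof -
  have "submonoid {\<one>} R"
    by unfold_locales auto
  then show ?thesis
    using assms by (auto simp: Den_iff ass_def)
qed

lemma max_Den_nonempty: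
  assumes "\<one> \<noteq> \<zero>"
  shows "max_Den\<^sub>l R \<noteq> {}"
proof -
  have "\<Union> C \<in> Den\<^sub>l R" if C: "C \<noteq> {}" "subset.chain (Den\<^sub>l R) C" for C
  proof -
    have CD: "C \<subseteq> Den\<^sub>l R" and lin: "\<And>S T. S \<in> C \<Longrightarrow> T \<in> C \<Longrightarrow> S \<subseteq> T \<or> T \<subseteq> S"
      using C(2) unfolding subset_chain_def by auto
    have "submonoid (\<Union> C) R"
    proof
      show "\<Union> C \<subseteq> carrier R"
        using CD Den_subset by blast
      show "\<one> \<in> \<Union> C"
        using C(1) CD Den_submonoid submonoid.one_closed by blast
      fix x y assume "x \<in> \<Union> C" "y \<in> \<Union> C"
      then obtain S\<^sub>x S\<^sub>y where "S\<^sub>x \<in> C" "x \<in> S\<^sub>x" "S\<^sub>y \<in> C" "y \<in> S\<^sub>y"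
        by blast
      then obtain S where S: "S \<in> C" "x \<in> S" "y \<in> S"
        using lin[of S\<^sub>x S\<^sub>y] by blast
      then have "submonoid S R"
        using CD Den_submonoid by blast
      then have "x \<otimes> y \<in> S"
        using S(2,3) by (rule submonoid.m_closed)
      with S(1) show "x \<otimes> y \<in> \<Union> C"
        by blast
    qed
    then have "monoid_closure R (\<Union> C) \<subseteq> \<Union> C"
      by (rule monoid_closure_minimal) simp
    then have eq: "monoid_closure R (\<Union> C) = \<Union> C"
      by (auto intro: monoid_closure.incl)
    then have "\<zero> \<notin> monoid_closure R (\<Union> C)"
      using CD Den_zero by blast
    then have "monoid_closure R (\<Union> C) \<in> Den\<^sub>l R"
      using CD by (intro Den_monoid_closure)
    then show ?thesis
      by (simp only: eq)
  qed
  then have "\<exists>M \<in> Den\<^sub>l R. \<forall>X \<in> Den\<^sub>l R. M \<subseteq> X \<longrightarrow> X = M"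
    using singleton_one_Den[OF assms] by (intro subset_Zorn_nonempty) auto
  then show ?thesis
    unfolding max_Den\<^sub>l_def by blast
qed

lemma T\<^sub>l_Den:
  assumes "\<one> \<noteq> \<zero>"
  shows "T\<^sub>l R \<in> Den\<^sub>l R"
proof -
  define F where "F = {S \<in> Den\<^sub>l R. S \<subseteq> Ls\<^sub>l R}"
  let ?W = "monoid_closure R (\<Union> F)"
  have T: "T\<^sub>l R = \<Union> F"
    unfolding T\<^sub>l_def F_def ..
  have W: "?W \<subseteq> M" if "M \<in> max_Den\<^sub>l R" for M
  proof (rule monoid_closure_minimal)
    show "submonoid M R"
      using that unfolding max_Den\<^sub>l_def by (blast intro: Den_submonoid)
    show "\<Union> F \<subseteq> M"
      using that unfolding F_def Ls\<^sub>l_def by blast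
  qed
  obtain M where M: "M \<in> max_Den\<^sub>l R"
    using max_Den_nonempty[OF assms] by blast
  then have "\<zero> \<notin> M"
    unfolding max_Den\<^sub>l_def by (blast dest: Den_zero)
  then have "\<zero> \<notin> ?W"
    using W[OF M] by blast
  then have WD: "?W \<in> Den\<^sub>l R"
    by (intro Den_monoid_closure) (auto simp: F_def)
  moreover have "?W \<subseteq> Ls\<^sub>l R"
    using W unfolding Ls\<^sub>l_def by blast
  ultimately have "?W \<subseteq> \<Union> F"
    unfolding F_def by blast
  then have "?W = \<Union> F"
    by (auto intro: monoid_closure.incl)
  then show ?thesis
    using WD T by simp
qed

lemma S\<^sub>l_subset_T\<^sub>l:
  assumes "\<aa> \<in> Ass\<^sub>l R" and "\<aa> \<subseteq> ls R"
  shows "S\<^sub>l R \<aa> \<subseteq> T\<^sub>l R"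
proof -
  note S = S\<^sub>l_greatest[OF assms(1)]
  have "S\<^sub>l R \<aa> \<subseteq> M" if M: "M \<in> max_Den\<^sub>l R" for M
  proof (rule subset_max_Den[OF S(1) M])
    have "T\<^sub>l R \<subseteq> M"
      using M unfolding T\<^sub>l_def Ls\<^sub>l_def by blast
    then show "ass R (S\<^sub>l R \<aa>) \<subseteq> ass R M"
      using S(2) assms(2) ass_mono unfolding ls_def by blast
  qed
  then show ?thesis
    using S(1) unfolding T\<^sub>l_def Ls\<^sub>l_def by blast
qed

end

section \<open>The left localization\<close>

locale left_denominator_set = ring R + S: submonoid S R
  for R :: "('a, 'm) ring_scheme" (structure) and S +
  assumes Den: "S \<in> Den\<^sub>l R"
begin

abbreviation frac :: "'a \<Rightarrow> 'a \<Rightarrow> ('a \<times> 'a) set"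
  where "frac \<equiv> left_frac R S"

abbreviation Q :: "('a \<times> 'a) set ring"
  where "Q \<equiv> left_localization R S"

lemma carr [simp]: "s \<in> S \<Longrightarrow> s \<in> carrier R"
  using S.subset by blast

lemma cancel:
  assumes "x \<in> carrier R" "y \<in> carrier R" "s \<in> S" "x \<otimes> s = y \<otimes> s"
  obtains k where "k \<in> S" "k \<otimes> x = k \<otimes> y"
proof -
  have "(x \<ominus> y) \<otimes> s = \<zero>"
    using assms by (simp add: minus_eq l_distr l_minus r_neg)
  then have "x \<ominus> y \<in> ass R S"
    using assms by (intro Den_right_annihilated[OF Den]) auto
  then obtain k where k: "k \<in> S" "k \<otimes> (x \<ominus> y) = \<zero>"
    by (rule assE)
  then have "k \<otimes> x \<oplus> \<ominus> (k \<otimes> y) = \<zero>"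
    using assms by (simp add: minus_eq r_distr r_minus)
  then have "\<ominus> (\<ominus> (k \<otimes> y)) = k \<otimes> x"
    using assms k(1) by (intro minus_equality) auto
  then have "k \<otimes> x = k \<otimes> y"
    using assms k(1) by simp
  with k(1) show ?thesis
    by (rule that)
qed

lemma common_multiple:
  assumes "s \<in> S" "t \<in> S"
  obtains c d where "c \<in> S" "d \<in> carrier R" "c \<otimes> s = d \<otimes> t" "c \<otimes> s \<in> S"
  using Den_Ore[OF Den, of s t] assms by (metis S.m_closed carr)

lemma frac_relI:
  assumes "s \<in> S" "r \<in> carrier R" "s' \<in> S" "r' \<in> carrier R" "c \<in> carrier R" "d \<in> carrier R"
    "c \<otimes> s = d \<otimes> s'" "c \<otimes> s \<in> S" "c \<otimes> r = d \<otimes> r'"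
  shows "((s, r), (s', r')) \<in> frac_rel R S"
  using assms unfolding frac_rel_def by blast

lemma frac_relE:
  assumes "((s, r), (s', r')) \<in> frac_rel R S"
  obtains c d where "s \<in> S" "r \<in> carrier R" "s' \<in> S" "r' \<in> carrier R"
    "c \<in> carrier R" "d \<in> carrier R" "c \<otimes> s = d \<otimes> s'" "c \<otimes> s \<in> S" "c \<otimes> r = d \<otimes> r'"
  using assms unfolding frac_rel_def by blast

lemma equiv_frac_rel: "equiv (S \<times> carrier R) (frac_rel R S)"
proof (rule equivI)
  show "frac_rel R S \<subseteq> (S \<times> carrier R) \<times> (S \<times> carrier R)"
    unfolding frac_rel_def by blast
  show "refl_on (S \<times> carrier R) (frac_rel R S)"
    by (auto simp: refl_on_def intro!: frac_relI[of _ _ _ _ \<one> \<one>])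
  show "sym (frac_rel R S)"
  proof (rule symI, clarify)
    fix s r s' r'
    assume "((s, r), (s', r')) \<in> frac_rel R S"
    then obtain c d where "s \<in> S" "r \<in> carrier R" "s' \<in> S" "r' \<in> carrier R"
      "c \<in> carrier R" "d \<in> carrier R" "c \<otimes> s = d \<otimes> s'" "c \<otimes> s \<in> S" "c \<otimes> r = d \<otimes> r'"
      by (rule frac_relE)
    then show "((s', r'), (s, r)) \<in> frac_rel R S"
      by (intro frac_relI[of _ _ _ _ d c]) simp_all
  qed
  show "trans (frac_rel R S)"
  proof (rule transI, clarify)
    fix s r s' r' s'' r''
    assume "((s, r), (s', r')) \<in> frac_rel R S"
    then obtain c d where cd: "s \<in> S" "r \<in> carrier R" "s' \<in> S" "r' \<in> carrier R"
      "c \<in> carrier R" "d \<in> carrier R" "c \<otimes> s = d \<otimes> s'" "c \<otimes> s \<in> S" "c \<otimes> r = d \<otimes> r'"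
      by (rule frac_relE)
    assume "((s', r'), (s'', r'')) \<in> frac_rel R S"
    then obtain e f where ef: "s'' \<in> S" "r'' \<in> carrier R"
      "e \<in> carrier R" "f \<in> carrier R" "e \<otimes> s' = f \<otimes> s''" "e \<otimes> s' \<in> S" "e \<otimes> r' = f \<otimes> r''"
      by (rule frac_relE)
    have ds': "d \<otimes> s' \<in> S"
      using cd(7,8) by simp
    note R = cd(5,6) ef(3,4)
    obtain g h where gh: "g \<in> S" "h \<in> carrier R" "g \<otimes> (d \<otimes> s') = h \<otimes> (e \<otimes> s')"
      using ds' ef(6) by (rule common_multiple)
    then have gd: "(g \<otimes> d) \<otimes> s' = (h \<otimes> e) \<otimes> s'"
      using cd(3) R by (simp add: m_assoc)
    obtain k where k: "k \<in> S" "k \<otimes> (g \<otimes> d) = k \<otimes> (h \<otimes> e)"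
      using cancel[OF _ _ cd(3) gd] R gh by auto
    have *: "(k \<otimes> (g \<otimes> c)) \<otimes> x = (k \<otimes> (h \<otimes> f)) \<otimes> x''"
      if "c \<otimes> x = d \<otimes> x'" "e \<otimes> x' = f \<otimes> x''"
        "x \<in> carrier R" "x' \<in> carrier R" "x'' \<in> carrier R" for x x' x''
    proof -
      have "(k \<otimes> (g \<otimes> c)) \<otimes> x = (k \<otimes> (g \<otimes> d)) \<otimes> x'"
        using that R gh(1) k(1) by (simp add: m_assoc)
      also have "\<dots> = (k \<otimes> (h \<otimes> f)) \<otimes> x''"
        unfolding k(2) using that R gh(2) k(1) by (simp add: m_assoc)
      finally show ?thesis .
    qed
    have "(k \<otimes> (g \<otimes> c)) \<otimes> s = k \<otimes> (g \<otimes> (c \<otimes> s))"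
      using cd(1,5) gh(1) k(1) by (simp add: m_assoc)
    also have "\<dots> \<in> S"
      using cd(8) gh(1) k(1) by blast
    finally show "((s, r), (s'', r'')) \<in> frac_rel R S"
      using cd(1-4) ef(1,2) R gh(1,2) k(1)
      by (intro frac_relI[of _ _ _ _ "k \<otimes> (g \<otimes> c)" "k \<otimes> (h \<otimes> f)"]
          *[OF cd(7) ef(5)] *[OF cd(9) ef(7)]) simp_all
  qed
qed

lemma frac_eq_iff:
  assumes "s \<in> S" "r \<in> carrier R" "s' \<in> S" "r' \<in> carrier R"
  shows "frac s r = frac s' r' \<longleftrightarrow> ((s, r), (s', r')) \<in> frac_rel R S"
  unfolding left_frac_def by (rule eq_equiv_class_iff[OF equiv_frac_rel]) (use assms in blast)+

lemma mem_frac: "s \<in> S \<Longrightarrow> r \<in> carrier R \<Longrightarrow> (s, r) \<in> frac s r"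
  unfolding left_frac_def by (rule equiv_class_self[OF equiv_frac_rel]) blast

lemma mem_fracD: "(s', r') \<in> frac s r \<Longrightarrow> ((s, r), (s', r')) \<in> frac_rel R S"
  unfolding left_frac_def by blast

lemma frac_expand:
  assumes "s \<in> S" "r \<in> carrier R" "c \<in> carrier R" "c \<otimes> s \<in> S"
  shows "frac (c \<otimes> s) (c \<otimes> r) = frac s r"
  using assms by (subst frac_eq_iff) (simp_all add: frac_relI[of _ _ _ _ \<one> c])

lemma frac_carrier [simp]: "s \<in> S \<Longrightarrow> r \<in> carrier R \<Longrightarrow> frac s r \<in> carrier Q"
  unfolding left_localization_def left_frac_def by (auto intro: quotientI)

lemma Q_cases:
  assumes "x \<in> carrier Q"
  obtains s r where "s \<in> S" "r \<in> carrier R" "x = frac s r"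
  using assms unfolding left_localization_def left_frac_def by (auto elim!: quotientE)

lemma frac_common_denominator:
  assumes "s \<in> S" "x \<in> carrier Q"
  obtains u c b where "c \<in> S" "u = c \<otimes> s" "u \<in> S" "b \<in> carrier R" "x = frac u b"
proof -
  obtain t r where t: "t \<in> S" "r \<in> carrier R" "x = frac t r"
    using assms(2) by (rule Q_cases)
  obtain c d where cd: "c \<in> S" "d \<in> carrier R" "c \<otimes> s = d \<otimes> t" "c \<otimes> s \<in> S"
    using assms(1) t(1) by (rule common_multiple)
  then have "x = frac (c \<otimes> s) (d \<otimes> r)"
    using t frac_expand[of t r d] by simp
  then show ?thesis
    using that cd t by blast
qed

lemma Q_cases2:
  assumes "x \<in> carrier Q" "y \<in> carrier Q"
  obtains u a b where "u \<in> S" "a \<in> carrier R" "b \<in> carrier R" "x = frac u a" "y = frac u b"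
proof -
  obtain s r where s: "s \<in> S" "r \<in> carrier R" "x = frac s r"
    using assms(1) by (rule Q_cases)
  obtain u c b where "c \<in> S" "u = c \<otimes> s" "u \<in> S" "b \<in> carrier R" "y = frac u b"
    using s(1) assms(2) by (rule frac_common_denominator)
  then show ?thesis
    using that[of u "c \<otimes> r" b] s frac_expand[of s r c] by simp
qed

lemma Q_cases3:
  assumes "x \<in> carrier Q" "y \<in> carrier Q" "z \<in> carrier Q"
  obtains u a b c where "u \<in> S" "a \<in> carrier R" "b \<in> carrier R" "c \<in> carrier R"
    "x = frac u a" "y = frac u b" "z = frac u c"
proof -
  obtain s a b where s: "s \<in> S" "a \<in> carrier R" "b \<in> carrier R" "x = frac s a" "y = frac s b"
    using assms(1,2) by (rule Q_cases2)
  obtain u d c where "d \<in> S" "u = d \<otimes> s" "u \<in> S" "c \<in> carrier R" "z = frac u c"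
    using s(1) assms(3) by (rule frac_common_denominator)
  then show ?thesis
    using that[of u "d \<otimes> a" "d \<otimes> b" c] s frac_expand[of s _ d] by simp
qed

text \<open>The multipliers \<open>a\<close> and \<open>a'\<close> need not lie in \<open>S\<close>: independence of the representatives
  uses products \<open>a = s\<^sub>2 c\<close> with \<open>c\<close> an expansion factor, which is arbitrary in \<open>R\<close>.\<close>

lemma frac_mult_indep:
  assumes S: "s \<in> S" "t \<in> S" "a \<otimes> s \<in> S" "a' \<otimes> s \<in> S"
    and R: "r \<in> carrier R" "q \<in> carrier R" "a \<in> carrier R" "a' \<in> carrier R"
      "b \<in> carrier R" "b' \<in> carrier R"
    and eq: "a \<otimes> r = b \<otimes> t" "a' \<otimes> r = b' \<otimes> t"
  shows "frac (a \<otimes> s) (b \<otimes> q) = frac (a' \<otimes> s) (b' \<otimes> q)"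
proof -
  obtain c d where cd: "c \<in> S" "d \<in> carrier R" "c \<otimes> (a \<otimes> s) = d \<otimes> (a' \<otimes> s)"
    using S(3,4) by (rule common_multiple)
  then have ca: "(c \<otimes> a) \<otimes> s = (d \<otimes> a') \<otimes> s"
    using S(1) R by (simp add: m_assoc)
  obtain k where k: "k \<in> S" "k \<otimes> (c \<otimes> a) = k \<otimes> (d \<otimes> a')"
    using cancel[OF _ _ S(1) ca] R cd(1,2) by auto
  have "(k \<otimes> (c \<otimes> b)) \<otimes> t = (k \<otimes> (c \<otimes> a)) \<otimes> r"
    using S(1,2) R cd(1,2) k(1) by (simp add: m_assoc eq)
  also have "\<dots> = (k \<otimes> (d \<otimes> b')) \<otimes> t"
    unfolding k(2) using S(1,2) R cd(1,2) k(1) by (simp add: m_assoc eq)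
  finally have kcb: "(k \<otimes> (c \<otimes> b)) \<otimes> t = (k \<otimes> (d \<otimes> b')) \<otimes> t" .
  obtain l where l: "l \<in> S" "l \<otimes> (k \<otimes> (c \<otimes> b)) = l \<otimes> (k \<otimes> (d \<otimes> b'))"
    using cancel[OF _ _ S(2) kcb] R cd(1,2) k(1) by auto
  have "(l \<otimes> (k \<otimes> c)) \<otimes> (a \<otimes> s) = (l \<otimes> (k \<otimes> d)) \<otimes> (a' \<otimes> s)"
    using S(1) R cd k(1) l(1) by (simp add: m_assoc)
  moreover have "(l \<otimes> (k \<otimes> c)) \<otimes> (b \<otimes> q) = (l \<otimes> (k \<otimes> (c \<otimes> b))) \<otimes> q"
    using R cd(1,2) k(1) l(1) by (simp add: m_assoc)
  moreover have "(l \<otimes> (k \<otimes> d)) \<otimes> (b' \<otimes> q) = (l \<otimes> (k \<otimes> (d \<otimes> b'))) \<otimes> q"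
    using R cd(1,2) k(1) l(1) by (simp add: m_assoc)
  moreover have "(l \<otimes> (k \<otimes> c)) \<otimes> (a \<otimes> s) \<in> S"
    using S(3) cd(1) k(1) l(1) by blast
  moreover have "l \<otimes> (k \<otimes> c) \<in> carrier R" "l \<otimes> (k \<otimes> d) \<in> carrier R"
    using cd(1,2) k(1) l(1) by simp_all
  ultimately have "((a \<otimes> s, b \<otimes> q), (a' \<otimes> s, b' \<otimes> q)) \<in> frac_rel R S"
    using S(3,4) R l(2) by (intro frac_relI[of _ _ _ _ "l \<otimes> (k \<otimes> c)" "l \<otimes> (k \<otimes> d)"]) simp_all
  then show ?thesis
    using S(3,4) R by (subst frac_eq_iff) simp_all
qed

lemma frac_mult_cong:
  assumes x: "((s, r), (s', r')) \<in> frac_rel R S" and y: "((t, q), (t', q')) \<in> frac_rel R S"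
    and S: "s\<^sub>1 \<in> S" "r\<^sub>1 \<in> carrier R" "s\<^sub>1 \<otimes> r = r\<^sub>1 \<otimes> t"
    and S': "s\<^sub>1' \<in> S" "r\<^sub>1' \<in> carrier R" "s\<^sub>1' \<otimes> r' = r\<^sub>1' \<otimes> t'"
  shows "frac (s\<^sub>1 \<otimes> s) (r\<^sub>1 \<otimes> q) = frac (s\<^sub>1' \<otimes> s') (r\<^sub>1' \<otimes> q')"
proof -
  obtain c d where cd: "s \<in> S" "r \<in> carrier R" "s' \<in> S" "r' \<in> carrier R"
    "c \<in> carrier R" "d \<in> carrier R" "c \<otimes> s = d \<otimes> s'" "c \<otimes> s \<in> S" "c \<otimes> r = d \<otimes> r'"
    using x by (rule frac_relE)
  obtain e f where ef: "t \<in> S" "q \<in> carrier R" "t' \<in> S" "q' \<in> carrier R"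
    "e \<in> carrier R" "f \<in> carrier R" "e \<otimes> t = f \<otimes> t'" "e \<otimes> t \<in> S" "e \<otimes> q = f \<otimes> q'"
    using y by (rule frac_relE)
  obtain s\<^sub>2 r\<^sub>2 where s2: "s\<^sub>2 \<in> S" "r\<^sub>2 \<in> carrier R" "s\<^sub>2 \<otimes> (c \<otimes> r) = r\<^sub>2 \<otimes> (e \<otimes> t)"
    using Den_Ore[OF Den, of "c \<otimes> r" "e \<otimes> t"] cd ef by auto
  have den: "(s\<^sub>2 \<otimes> c) \<otimes> s = (s\<^sub>2 \<otimes> d) \<otimes> s'" "(s\<^sub>2 \<otimes> c) \<otimes> s \<in> S"
    using cd s2 by (simp_all add: m_assoc)
  have num: "(r\<^sub>2 \<otimes> e) \<otimes> q = (r\<^sub>2 \<otimes> f) \<otimes> q'"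
    using ef s2 by (simp add: m_assoc)
  have "frac (s\<^sub>1 \<otimes> s) (r\<^sub>1 \<otimes> q) = frac ((s\<^sub>2 \<otimes> c) \<otimes> s) ((r\<^sub>2 \<otimes> e) \<otimes> q)"
    using S cd ef s2 den by (intro frac_mult_indep[of s t _ _ r]) (auto simp: m_assoc)
  also have "\<dots> = frac ((s\<^sub>2 \<otimes> d) \<otimes> s') ((r\<^sub>2 \<otimes> f) \<otimes> q')"
    by (simp only: den(1) num)
  also have "\<dots> = frac (s\<^sub>1' \<otimes> s') (r\<^sub>1' \<otimes> q')"
    using S' cd ef s2 den by (intro frac_mult_indep[of s' t' _ _ r']) (auto simp: m_assoc)
  finally show ?thesis .
qed

lemma mult_frac:
  assumes "s \<in> S" "r \<in> carrier R" "t \<in> S" "q \<in> carrier R"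
    and "s\<^sub>1 \<in> S" "r\<^sub>1 \<in> carrier R" "s\<^sub>1 \<otimes> r = r\<^sub>1 \<otimes> t"
  shows "frac s r \<otimes>\<^bsub>Q\<^esub> frac t q = frac (s\<^sub>1 \<otimes> s) (r\<^sub>1 \<otimes> q)"
proof -
  have "{frac (s\<^sub>1' \<otimes> s') (r\<^sub>1' \<otimes> q') | s' r' t' q' s\<^sub>1' r\<^sub>1'.
      (s', r') \<in> frac s r \<and> (t', q') \<in> frac t q \<and> s\<^sub>1' \<in> S \<and> r\<^sub>1' \<in> carrier R \<and>
      s\<^sub>1' \<otimes> r' = r\<^sub>1' \<otimes> t'} = {frac (s\<^sub>1 \<otimes> s) (r\<^sub>1 \<otimes> q)}" (is "?A = {?z}")
  proof (intro equalityI subsetI)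
    fix z assume "z \<in> ?A"
    then show "z \<in> {?z}"
      using frac_mult_cong[OF mem_fracD mem_fracD assms(5-7)] by auto
  next
    fix z assume "z \<in> {?z}"
    then show "z \<in> ?A"
      using assms mem_frac by blast
  qed
  then show ?thesis
    unfolding left_localization_def by simp
qed

lemma frac_add_cong:
  assumes "((u, a), (v, a')) \<in> frac_rel R S" and "((u, b), (v, b')) \<in> frac_rel R S"
  shows "frac u (a \<oplus> b) = frac v (a' \<oplus> b')"
proof -
  obtain c d where cd: "u \<in> S" "a \<in> carrier R" "v \<in> S" "a' \<in> carrier R"
    "c \<in> carrier R" "d \<in> carrier R" "c \<otimes> u = d \<otimes> v" "c \<otimes> u \<in> S" "c \<otimes> a = d \<otimes> a'"
    using assms(1) by (rule frac_relE)
  obtain c' d' where cd': "b \<in> carrier R" "b' \<in> carrier R"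
    "c' \<in> carrier R" "d' \<in> carrier R" "c' \<otimes> u = d' \<otimes> v" "c' \<otimes> u \<in> S" "c' \<otimes> b = d' \<otimes> b'"
    using assms(2) by (rule frac_relE)
  obtain e f where ef: "e \<in> S" "f \<in> carrier R" "e \<otimes> (c \<otimes> u) = f \<otimes> (c' \<otimes> u)"
    using cd(8) cd'(6) by (rule common_multiple)
  then have ec: "(e \<otimes> c) \<otimes> u = (f \<otimes> c') \<otimes> u"
    using cd(1,5) cd'(3) by (simp add: m_assoc)
  obtain k where k: "k \<in> S" "k \<otimes> (e \<otimes> c) = k \<otimes> (f \<otimes> c')"
    using cancel[OF _ _ cd(1) ec] cd(5) cd'(3) ef(1,2) by auto
  have "(k \<otimes> (e \<otimes> d)) \<otimes> v = (k \<otimes> (e \<otimes> c)) \<otimes> u"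
    using cd ef(1,2) k(1) by (simp add: m_assoc)
  also have "\<dots> = (k \<otimes> (f \<otimes> d')) \<otimes> v"
    unfolding k(2) using cd(1,3,5,6) cd'(3-5) ef(1,2) k(1) by (simp add: m_assoc)
  finally have ked: "(k \<otimes> (e \<otimes> d)) \<otimes> v = (k \<otimes> (f \<otimes> d')) \<otimes> v" .
  obtain l where l: "l \<in> S" "l \<otimes> (k \<otimes> (e \<otimes> d)) = l \<otimes> (k \<otimes> (f \<otimes> d'))"
    using cancel[OF _ _ cd(3) ked] cd(6) cd'(4) ef(1,2) k(1) by auto
  define C where "C = l \<otimes> (k \<otimes> (e \<otimes> c))"
  define D where "D = l \<otimes> (k \<otimes> (e \<otimes> d))"
  have C': "C = l \<otimes> (k \<otimes> (f \<otimes> c'))" and D': "D = l \<otimes> (k \<otimes> (f \<otimes> d'))"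
    unfolding C_def D_def using k(2) l(2) by simp_all
  have CD: "C \<in> carrier R" "D \<in> carrier R"
    unfolding C_def D_def using cd ef k(1) l(1) by simp_all
  have Cu: "C \<otimes> u = l \<otimes> (k \<otimes> (e \<otimes> (c \<otimes> u)))"
    unfolding C_def using cd(1-6) ef(1) k(1) l(1) by (simp add: m_assoc)
  have "C \<otimes> u = D \<otimes> v"
    unfolding Cu unfolding D_def using cd ef(1) k(1) l(1) by (simp add: m_assoc)
  moreover have "C \<otimes> u \<in> S"
    unfolding Cu using cd ef(1) k(1) l(1) by blast
  moreover have "C \<otimes> a = D \<otimes> a'"
    unfolding C_def D_def using cd ef(1) k(1) l(1) by (simp add: m_assoc)
  moreover have "C \<otimes> b = D \<otimes> b'"
    unfolding C' D' using cd' ef(1,2) k(1) l(1) by (simp add: m_assoc)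
  ultimately have "((u, a \<oplus> b), (v, a' \<oplus> b')) \<in> frac_rel R S"
    using cd cd' CD by (intro frac_relI[of _ _ _ _ C D]) (auto simp: r_distr)
  then show ?thesis
    using cd cd' by (subst frac_eq_iff) auto
qed

lemma add_frac:
  assumes "u \<in> S" "a \<in> carrier R" "b \<in> carrier R"
  shows "frac u a \<oplus>\<^bsub>Q\<^esub> frac u b = frac u (a \<oplus> b)"
proof -
  have "{frac v (a' \<oplus> b') | v a' b'. (v, a') \<in> frac u a \<and> (v, b') \<in> frac u b} = {frac u (a \<oplus> b)}"
    (is "?A = {?z}")
  proof (intro equalityI subsetI)
    fix z assume "z \<in> ?A"
    then show "z \<in> {?z}"
      using frac_add_cong[OF mem_fracD mem_fracD] by auto
  next
    fix z assume "z \<in> {?z}"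
    then show "z \<in> ?A"
      using assms mem_frac by blast
  qed
  then show ?thesis
    unfolding left_localization_def by simp
qed

lemma one_Q: "\<one>\<^bsub>Q\<^esub> = frac \<one> \<one>"
  unfolding left_localization_def by simp

lemma zero_Q:
  assumes "u \<in> S"
  shows "\<zero>\<^bsub>Q\<^esub> = frac u \<zero>"
  using frac_expand[of \<one> \<zero> u] assms unfolding left_localization_def by simp

lemma mult_fracE:
  assumes "s \<in> S" "r \<in> carrier R" "t \<in> S"
  obtains s\<^sub>1 r\<^sub>1 where "s\<^sub>1 \<in> S" "r\<^sub>1 \<in> carrier R" "s\<^sub>1 \<otimes> r = r\<^sub>1 \<otimes> t"
    "\<And>q. q \<in> carrier R \<Longrightarrow> frac s r \<otimes>\<^bsub>Q\<^esub> frac t q = frac (s\<^sub>1 \<otimes> s) (r\<^sub>1 \<otimes> q)"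
  using Den_Ore[OF Den assms(2,3)] mult_frac assms by metis

lemma abelian_group_Q: "abelian_group Q"
proof (rule abelian_groupI)
  fix x y assume "x \<in> carrier Q" "y \<in> carrier Q"
  then obtain u a b where "u \<in> S" "a \<in> carrier R" "b \<in> carrier R" "x = frac u a" "y = frac u b"
    by (rule Q_cases2)
  then show "x \<oplus>\<^bsub>Q\<^esub> y \<in> carrier Q" "x \<oplus>\<^bsub>Q\<^esub> y = y \<oplus>\<^bsub>Q\<^esub> x"
    by (simp_all add: add_frac a_comm)
next
  fix x y z assume "x \<in> carrier Q" "y \<in> carrier Q" "z \<in> carrier Q"
  then obtain u a b c where "u \<in> S" "a \<in> carrier R" "b \<in> carrier R" "c \<in> carrier R"
    "x = frac u a" "y = frac u b" "z = frac u c"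
    by (rule Q_cases3)
  then show "x \<oplus>\<^bsub>Q\<^esub> y \<oplus>\<^bsub>Q\<^esub> z = x \<oplus>\<^bsub>Q\<^esub> (y \<oplus>\<^bsub>Q\<^esub> z)"
    by (simp add: add_frac a_assoc)
next
  show "\<zero>\<^bsub>Q\<^esub> \<in> carrier Q"
    by (simp add: zero_Q[of \<one>])
next
  fix x assume "x \<in> carrier Q"
  then obtain s r where x: "s \<in> S" "r \<in> carrier R" "x = frac s r"
    by (rule Q_cases)
  then show "\<zero>\<^bsub>Q\<^esub> \<oplus>\<^bsub>Q\<^esub> x = x"
    by (simp add: zero_Q[of s] add_frac)
  have "frac s (\<ominus> r) \<oplus>\<^bsub>Q\<^esub> x = \<zero>\<^bsub>Q\<^esub>"
    using x by (simp add: zero_Q[of s] add_frac l_neg)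
  then show "\<exists>y\<in>carrier Q. y \<oplus>\<^bsub>Q\<^esub> x = \<zero>\<^bsub>Q\<^esub>"
    using x by (intro bexI[of _ "frac s (\<ominus> r)"]) auto
qed

lemma monoid_Q: "Group.monoid Q"
proof
  fix x y assume "x \<in> carrier Q" "y \<in> carrier Q"
  then obtain u a b where "u \<in> S" "a \<in> carrier R" "b \<in> carrier R" "x = frac u a" "y = frac u b"
    by (rule Q_cases2)
  then show "x \<otimes>\<^bsub>Q\<^esub> y \<in> carrier Q"
    using mult_fracE[of u a u] by (metis S.m_closed frac_carrier m_closed)
next
  show "\<one>\<^bsub>Q\<^esub> \<in> carrier Q"
    by (simp add: one_Q)
next
  fix x assume "x \<in> carrier Q"
  then obtain s r where x: "s \<in> S" "r \<in> carrier R" "x = frac s r"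
    by (rule Q_cases)
  then show "\<one>\<^bsub>Q\<^esub> \<otimes>\<^bsub>Q\<^esub> x = x" "x \<otimes>\<^bsub>Q\<^esub> \<one>\<^bsub>Q\<^esub> = x"
    using mult_frac[of \<one> \<one> s r s \<one>] mult_frac[of s r \<one> \<one> \<one> r] by (simp_all add: one_Q)
next
  fix x y z assume carrier: "x \<in> carrier Q" "y \<in> carrier Q" "z \<in> carrier Q"
  obtain s r where x: "s \<in> S" "r \<in> carrier R" "x = frac s r"
    using carrier(1) by (rule Q_cases)
  obtain t q where y: "t \<in> S" "q \<in> carrier R" "y = frac t q"
    using carrier(2) by (rule Q_cases)
  obtain u p where z: "u \<in> S" "p \<in> carrier R" "z = frac u p"
    using carrier(3) by (rule Q_cases)
  obtain s\<^sub>1 r\<^sub>1 where 1: "s\<^sub>1 \<in> S" "r\<^sub>1 \<in> carrier R" "s\<^sub>1 \<otimes> r = r\<^sub>1 \<otimes> t"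
    using Den_Ore[OF Den x(2) y(1)] by blast
  obtain s\<^sub>2 r\<^sub>2 where 2: "s\<^sub>2 \<in> S" "r\<^sub>2 \<in> carrier R" "s\<^sub>2 \<otimes> q = r\<^sub>2 \<otimes> u"
    using Den_Ore[OF Den y(2) z(1)] by blast
  obtain s\<^sub>3 r\<^sub>3 where 3: "s\<^sub>3 \<in> S" "r\<^sub>3 \<in> carrier R" "s\<^sub>3 \<otimes> r\<^sub>1 = r\<^sub>3 \<otimes> s\<^sub>2"
    using Den_Ore[OF Den 1(2) 2(1)] by blast
  have e1: "s\<^sub>3 \<otimes> (r\<^sub>1 \<otimes> q) = (r\<^sub>3 \<otimes> r\<^sub>2) \<otimes> u"
  proof -
    have "s\<^sub>3 \<otimes> (r\<^sub>1 \<otimes> q) = (s\<^sub>3 \<otimes> r\<^sub>1) \<otimes> q"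
      using y 1(1,2) 3(1) by (simp add: m_assoc)
    also have "\<dots> = (r\<^sub>3 \<otimes> r\<^sub>2) \<otimes> u"
      unfolding 3(3) using y z 2 3(1,2) by (simp add: m_assoc)
    finally show ?thesis .
  qed
  have e2: "(s\<^sub>3 \<otimes> s\<^sub>1) \<otimes> r = r\<^sub>3 \<otimes> (s\<^sub>2 \<otimes> t)"
  proof -
    have "(s\<^sub>3 \<otimes> s\<^sub>1) \<otimes> r = (s\<^sub>3 \<otimes> r\<^sub>1) \<otimes> t"
      using x y 1 3(1) by (simp add: m_assoc)
    also have "\<dots> = r\<^sub>3 \<otimes> (s\<^sub>2 \<otimes> t)"
      unfolding 3(3) using y 2(1) 3(1,2) by (simp add: m_assoc)
    finally show ?thesis .
  qed
  have "x \<otimes>\<^bsub>Q\<^esub> y \<otimes>\<^bsub>Q\<^esub> z = frac (s\<^sub>1 \<otimes> s) (r\<^sub>1 \<otimes> q) \<otimes>\<^bsub>Q\<^esub> frac u p"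
    using x y z 1 mult_frac by simp
  also have "\<dots> = frac (s\<^sub>3 \<otimes> (s\<^sub>1 \<otimes> s)) ((r\<^sub>3 \<otimes> r\<^sub>2) \<otimes> p)"
    using x y z 1 2 3 e1 by (intro mult_frac) auto
  also have "\<dots> = frac ((s\<^sub>3 \<otimes> s\<^sub>1) \<otimes> s) (r\<^sub>3 \<otimes> (r\<^sub>2 \<otimes> p))"
    using x z 1(1) 2(2) 3(1,2) by (simp add: m_assoc)
  also have "\<dots> = frac s r \<otimes>\<^bsub>Q\<^esub> frac (s\<^sub>2 \<otimes> t) (r\<^sub>2 \<otimes> p)"
    using x y z 1 2 3 e2 by (intro mult_frac[symmetric]) auto
  also have "\<dots> = x \<otimes>\<^bsub>Q\<^esub> (y \<otimes>\<^bsub>Q\<^esub> z)"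
    using x y z 2 mult_frac by simp
  finally show "x \<otimes>\<^bsub>Q\<^esub> y \<otimes>\<^bsub>Q\<^esub> z = x \<otimes>\<^bsub>Q\<^esub> (y \<otimes>\<^bsub>Q\<^esub> z)" .
qed

lemma ring_Q: "ring Q"
proof (rule ringI[OF abelian_group_Q monoid_Q])
  fix x y z assume carrier: "x \<in> carrier Q" "y \<in> carrier Q" "z \<in> carrier Q"
  obtain s a b where xy: "s \<in> S" "a \<in> carrier R" "b \<in> carrier R" "x = frac s a" "y = frac s b"
    using carrier(1,2) by (rule Q_cases2)
  obtain t q where z: "t \<in> S" "q \<in> carrier R" "z = frac t q"
    using carrier(3) by (rule Q_cases)
  obtain s\<^sub>1 a\<^sub>1 where 1: "s\<^sub>1 \<in> S" "a\<^sub>1 \<in> carrier R" "s\<^sub>1 \<otimes> a = a\<^sub>1 \<otimes> t"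
    using Den_Ore[OF Den xy(2) z(1)] by blast
  obtain s\<^sub>2 b\<^sub>1 where 2: "s\<^sub>2 \<in> S" "b\<^sub>1 \<in> carrier R" "s\<^sub>2 \<otimes> (s\<^sub>1 \<otimes> b) = b\<^sub>1 \<otimes> t"
    using Den_Ore[OF Den _ z(1), of "s\<^sub>1 \<otimes> b"] 1 xy by auto
  have xz: "x \<otimes>\<^bsub>Q\<^esub> z = frac ((s\<^sub>2 \<otimes> s\<^sub>1) \<otimes> s) ((s\<^sub>2 \<otimes> a\<^sub>1) \<otimes> q)"
    unfolding xy(4) z(3) using xy(1-3) z 1 2 by (intro mult_frac) (simp_all add: m_assoc)
  have yz: "y \<otimes>\<^bsub>Q\<^esub> z = frac ((s\<^sub>2 \<otimes> s\<^sub>1) \<otimes> s) (b\<^sub>1 \<otimes> q)"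
    unfolding xy(5) z(3) using xy(1-3) z 1 2 by (intro mult_frac) (simp_all add: m_assoc)
  have "(x \<oplus>\<^bsub>Q\<^esub> y) \<otimes>\<^bsub>Q\<^esub> z = frac s (a \<oplus> b) \<otimes>\<^bsub>Q\<^esub> frac t q"
    using xy z by (simp add: add_frac)
  also have "\<dots> = frac ((s\<^sub>2 \<otimes> s\<^sub>1) \<otimes> s) ((s\<^sub>2 \<otimes> a\<^sub>1 \<oplus> b\<^sub>1) \<otimes> q)"
    using xy z 1 2 by (intro mult_frac) (auto simp: m_assoc r_distr l_distr)
  also have "\<dots> = x \<otimes>\<^bsub>Q\<^esub> z \<oplus>\<^bsub>Q\<^esub> y \<otimes>\<^bsub>Q\<^esub> z"
    unfolding xz yz using xy z 1 2 by (simp add: add_frac l_distr)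
  finally show "(x \<oplus>\<^bsub>Q\<^esub> y) \<otimes>\<^bsub>Q\<^esub> z = x \<otimes>\<^bsub>Q\<^esub> z \<oplus>\<^bsub>Q\<^esub> y \<otimes>\<^bsub>Q\<^esub> z" .
  obtain s\<^sub>3 t\<^sub>3 where "s\<^sub>3 \<in> S" "t\<^sub>3 \<in> carrier R"
    "\<And>p. p \<in> carrier R \<Longrightarrow> frac t q \<otimes>\<^bsub>Q\<^esub> frac s p = frac (s\<^sub>3 \<otimes> t) (t\<^sub>3 \<otimes> p)"
    using mult_fracE[OF z(1,2) xy(1)] by metis
  then show "z \<otimes>\<^bsub>Q\<^esub> (x \<oplus>\<^bsub>Q\<^esub> y) = z \<otimes>\<^bsub>Q\<^esub> x \<oplus>\<^bsub>Q\<^esub> z \<otimes>\<^bsub>Q\<^esub> y"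
    using xy z by (simp add: add_frac r_distr)
qed

end

lemma (in ring) left_denominator_setI: "S \<in> Den\<^sub>l R \<Longrightarrow> left_denominator_set R S"
  by (intro left_denominator_set.intro left_denominator_set_axioms.intro Den_submonoid ring_axioms)

lemma (in ring) ring_hom_left_localization:
  assumes "S \<in> Den\<^sub>l R" and "T \<in> Den\<^sub>l R" and ST: "S \<subseteq> T"
  obtains h where "ring_hom_ring (left_localization R S) (left_localization R T) h"
    and "\<And>s r. s \<in> S \<Longrightarrow> r \<in> carrier R \<Longrightarrow> h (left_frac R S s r) = left_frac R T s r"
proof -
  interpret S: left_denominator_set R S
    using assms(1) by (rule left_denominator_setI)
  interpret T: left_denominator_set R T
    using assms(2) by (rule left_denominator_setI)
  have T: "s \<in> T" if "s \<in> S" for s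
    using that ST by (rule rev_subsetD)
  have sub: "frac_rel R S \<subseteq> frac_rel R T"
    using ST unfolding frac_rel_def by blast
  define h where "h x = frac_rel R T `` x" for x
  have h: "h (S.frac s r) = T.frac s r" if sr: "s \<in> S" "r \<in> carrier R" for s r
  proof -
    have "frac_rel R T `` {p} = T.frac s r" if "p \<in> S.frac s r" for p
    proof -
      have "((s, r), p) \<in> frac_rel R S"
        using that unfolding left_frac_def by blast
      with sub have "((s, r), p) \<in> frac_rel R T"
        by (rule subsetD)
      then show ?thesis
        unfolding left_frac_def by (rule equiv_class_eq[OF T.equiv_frac_rel, symmetric])
    qed
    with S.mem_frac[OF sr] show ?thesis
      unfolding h_def by blast
  qed
  have "ring_hom_ring S.Q T.Q h"
  proof (rule ring_hom_ringI[OF S.ring_Q T.ring_Q])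
    fix x assume "x \<in> carrier S.Q"
    then obtain s r where "s \<in> S" "r \<in> carrier R" "x = S.frac s r"
      by (rule S.Q_cases)
    then show "h x \<in> carrier T.Q"
      by (simp add: h T)
  next
    fix x y assume xy: "x \<in> carrier S.Q" "y \<in> carrier S.Q"
    then obtain u a b where u: "u \<in> S" "a \<in> carrier R" "b \<in> carrier R"
      and eq: "x = S.frac u a" "y = S.frac u b"
      by (rule S.Q_cases2)
    show "h (x \<oplus>\<^bsub>S.Q\<^esub> y) = h x \<oplus>\<^bsub>T.Q\<^esub> h y"
      unfolding eq using u by (simp add: S.add_frac T.add_frac h T)
    obtain s\<^sub>1 r\<^sub>1 where 1: "s\<^sub>1 \<in> S" "r\<^sub>1 \<in> carrier R" "s\<^sub>1 \<otimes> a = r\<^sub>1 \<otimes> u"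
      using Den_Ore[OF assms(1) u(2,1)] by blast
    have "h (x \<otimes>\<^bsub>S.Q\<^esub> y) = T.frac (s\<^sub>1 \<otimes> u) (r\<^sub>1 \<otimes> b)"
      unfolding eq using S.mult_frac[OF u(1,2,1,3) 1] u 1(1,2) by (simp add: h)
    also have "\<dots> = h x \<otimes>\<^bsub>T.Q\<^esub> h y"
      unfolding eq using T.mult_frac[OF T[OF u(1)] u(2) T[OF u(1)] u(3) T[OF 1(1)] 1(2,3)] u
      by (simp add: h)
    finally show "h (x \<otimes>\<^bsub>S.Q\<^esub> y) = h x \<otimes>\<^bsub>T.Q\<^esub> h y" .
  next
    show "h \<one>\<^bsub>S.Q\<^esub> = \<one>\<^bsub>T.Q\<^esub>"
      by (simp add: S.one_Q T.one_Q h)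
  qed
  then show ?thesis
    using h by (rule that)
qed

theorem theorem1p5:
  fixes R :: "('a, 'm) ring_scheme" and \<aa> :: "'a set"
  assumes "ring R" and "\<one>\<^bsub>R\<^esub> \<noteq> \<zero>\<^bsub>R\<^esub>"
    and "\<aa> \<in> Ass\<^sub>l R" and "\<aa> \<subseteq> ls R"
  shows "S\<^sub>l R \<aa> \<subseteq> T\<^sub>l R \<and>
    (\<exists>h. ring_hom_under R (Q\<^sub>l R \<aa>) (canonical_map R (S\<^sub>l R \<aa>)) (Qs\<^sub>l R) (canonical_map R (T\<^sub>l R)) h \<and>
         (\<forall>s \<in> S\<^sub>l R \<aa>. \<forall>r \<in> carrier R. h (left_frac R (S\<^sub>l R \<aa>) s r) = left_frac R (T\<^sub>l R) s r))"
proof -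
  interpret ring R by fact
  have sub: "S\<^sub>l R \<aa> \<subseteq> T\<^sub>l R"
    using assms(3,4) by (rule S\<^sub>l_subset_T\<^sub>l)
  have S: "S\<^sub>l R \<aa> \<in> Den\<^sub>l R"
    using assms(3) by (rule S\<^sub>l_greatest)
  have one: "\<one>\<^bsub>R\<^esub> \<in> S\<^sub>l R \<aa>"
    using Den_submonoid[OF S] by (rule submonoid.one_closed)
  obtain h where "ring_hom_ring (Q\<^sub>l R \<aa>) (Qs\<^sub>l R) h"
    and "\<And>s r. s \<in> S\<^sub>l R \<aa> \<Longrightarrow> r \<in> carrier R \<Longrightarrow> h (left_frac R (S\<^sub>l R \<aa>) s r) = left_frac R (T\<^sub>l R) s r"
    by (rule ring_hom_left_localization[OF S T\<^sub>l_Den[OF assms(2)] sub, folded Q\<^sub>l_def Qs\<^sub>l_def])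
      (rule that)
  then show ?thesis
    using sub one unfolding ring_hom_under_def canonical_map_def by blast
qed

end
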